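(* Let $G=(V,E)$ be a multigraph, let $k$ be a positive integer, and let $c:V\rightarrow \mathbf{Z}_{+}$ be a function satisfying $c(v)\leq \min\{\mathrm{deg}(v),k\}$ for every $v\in V$. If $S=\{v\in V\mid c(v)+\mu(v)>k\}$ is a stable set in $G$, then there exists an assignment of colors $\pi:E\rightarrow [k]$ such that $$|\pi(\delta(v))|\geq c(v)$$ holds for every $v\in V$.
   Context: Multigraphs are finite and undirected; parallel edges are allowed and each edge joins two distinct vertices. $\mathbf{Z}_{+}$ denotes the set of nonnegative integers and $[k]=\{1,2,\ldots,k\}$. For a vertex $v\in V$, $\delta(v)$ is the set of edges incident to $v$, $\mathrm{deg}(v)=|\delta(v)|$, and $\mu(v)$ is the maximum number of parallel edges incident to $v$, i.e. the maximum over vertices $w\neq v$ of the number of edges between $v$ and $w$ (which is $0$ if no edge is incident to $v$). A stable set is a set of vertices no two of which are joined by an edge. For $\pi:E\rightarrow [k]$ and $X\subseteq E$, $\pi(X)=\{\pi(e)\mid e\in X\}$. The assignment $\pi$ is an arbitrary function (adjacent edges may receive the same color). *)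

theory Defs
  imports "HOL-Library.FuncSet"
begin

text \<open>Edges are elements of a set of their own, so that parallel edges are distinct elements of
  \<open>E\<close> with the same (unordered) pair of ends; \<open>card (ends e) = 2\<close> excludes loops.\<close>

locale multigraph =
  fixes V :: "'v set" and E :: "'e set" and ends :: "'e \<Rightarrow> 'v set"
  assumes finite_verts: "finite V"
    and finite_edges: "finite E"
    and ends_subset: "e \<in> E \<Longrightarrow> ends e \<subseteq> V"
    and card_ends: "e \<in> E \<Longrightarrow> card (ends e) = 2"

definition incident_edges :: "'e set \<Rightarrow> ('e \<Rightarrow> 'v set) \<Rightarrow> 'v \<Rightarrow> 'e set" where
  "incident_edges E ends v = {e \<in> E. v \<in> ends e}"

definition vertex_degree :: "'e set \<Rightarrow> ('e \<Rightarrow> 'v set) \<Rightarrow> 'v \<Rightarrow> nat" where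
  "vertex_degree E ends v = card (incident_edges E ends v)"

definition edges_between :: "'e set \<Rightarrow> ('e \<Rightarrow> 'v set) \<Rightarrow> 'v \<Rightarrow> 'v \<Rightarrow> 'e set" where
  "edges_between E ends v w = {e \<in> E. ends e = {v, w}}"

text \<open>The inserted \<open>0\<close> only matters when \<open>v\<close> is the sole vertex, where the maximum
  would otherwise range over the empty set.\<close>

definition max_multiplicity :: "'v set \<Rightarrow> 'e set \<Rightarrow> ('e \<Rightarrow> 'v set) \<Rightarrow> 'v \<Rightarrow> nat" where
  "max_multiplicity V E ends v =
     Max (insert 0 ((\<lambda>w. card (edges_between E ends v w)) ` (V - {v})))"

definition stable_set :: "'v set \<Rightarrow> 'e set \<Rightarrow> ('e \<Rightarrow> 'v set) \<Rightarrow> 'v set \<Rightarrow> bool" where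
  "stable_set V E ends X \<longleftrightarrow>
     X \<subseteq> V \<and> (\<forall>u\<in>X. \<forall>w\<in>X. edges_between E ends u w = {})"

end

theory Submission
  imports Defs "HOL-Combinatorics.Transposition"
begin

text \<open>Keep \<open>c v\<close> of the edges at each vertex \<open>v\<close> and detach every other edge end at \<open>v\<close>
  to a new vertex of degree one. A proper \<open>k\<close>-edge-colouring of the resulting multigraph is the
  required assignment; its degrees are at most \<open>k\<close>, and the vertices whose degree plus
  multiplicity exceeds \<open>k\<close> still form a stable set. Such a colouring is built edge by edge by
  Vizing's fan argument. The centre \<open>x\<close> of the fan has to be chosen so that every neighbour
  satisfies degree plus multiplicity at most \<open>k\<close>: it is a vertex that violates this bound if
  some edge has such an end, and an arbitrary end of an edge otherwise. Counting the colours
  missing at the fan vertices against the edges of the fan gives the contradiction.\<close>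

section \<open>Incidence, degrees and multiplicities in subgraphs\<close>

lemma incident_edges_iff [simp]: "e \<in> incident_edges E ends v \<longleftrightarrow> e \<in> E \<and> v \<in> ends e"
  by (simp add: incident_edges_def)

lemma finite_incident_edges [simp]: "finite E \<Longrightarrow> finite (incident_edges E ends v)"
  by (simp add: incident_edges_def)

lemma incident_edges_Diff: "incident_edges (E - A) ends v = incident_edges E ends v - A"
  by auto

lemma vertex_degree_mono:
  "finite E \<Longrightarrow> F \<subseteq> E \<Longrightarrow> vertex_degree F ends v \<le> vertex_degree E ends v"
  unfolding vertex_degree_def by (rule card_mono) auto

lemma card_edges_between_mono:
  "finite E \<Longrightarrow> F \<subseteq> E \<Longrightarrow> card (edges_between F ends v w) \<le> card (edges_between E ends v w)"
  by (rule card_mono) (auto simp: edges_between_def)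

lemma card_2_other_end: "card A = 2 \<Longrightarrow> x \<in> A \<Longrightarrow> \<exists>y. A = {x, y} \<and> y \<noteq> x"
  by (metis card_2_iff doubleton_eq_iff insertE singletonD)

section \<open>Components of graphs of maximum degree two\<close>

text \<open>The closed set \<open>C\<close> is the vertex set of a path from \<open>x\<close> to \<open>z\<close>.\<close>

lemma path_component:
  assumes "finite F" and "\<And>e. e \<in> F \<Longrightarrow> card (ends e) = 2"
    and "\<And>v. vertex_degree F ends v \<le> 2" and "vertex_degree F ends x \<le> 1"
  shows "\<exists>C z. x \<in> C \<and> (\<forall>e\<in>F. ends e \<inter> C \<noteq> {} \<longrightarrow> ends e \<subseteq> C) \<and>
           (\<forall>v\<in>C. vertex_degree F ends v \<le> 1 \<longrightarrow> v = x \<or> v = z)"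
  using assms
proof (induction "card F" arbitrary: F x rule: less_induct)
  case less
  show ?case
  proof (cases "incident_edges F ends x = {}")
    case True
    then have "\<forall>e\<in>F. ends e \<inter> {x} \<noteq> {} \<longrightarrow> ends e \<subseteq> {x}"
      by (auto simp: incident_edges_def)
    then show ?thesis
      by (intro exI[of _ "{x}"] exI[of _ x]) simp
  next
    case False
    have "card (incident_edges F ends x) \<noteq> 0"
      using False less.prems(1) by simp
    then have "card (incident_edges F ends x) = 1"
      using less.prems(4) by (simp add: vertex_degree_def)
    then obtain e where e: "incident_edges F ends x = {e}"
      by (auto simp: card_1_singleton_iff)
    then have eF: "e \<in> F" "x \<in> ends e"
      by (metis incident_edges_iff singletonI)+
    have only_e: "f = e" if "f \<in> F" "x \<in> ends f" for f
      using that e by (metis incident_edges_iff singletonD)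
    obtain y where y: "ends e = {x, y}" "y \<noteq> x"
      using card_2_other_end[OF less.prems(2)[OF eF(1)] eF(2)] by blast
    \<comment> \<open>Without its only edge \<open>x\<close> is isolated, and the path continues
      from \<open>y\<close>, whose degree has dropped to at most one. So \<open>F'\<close> and
      \<open>y\<close> meet the requirements of the induction hypothesis.\<close>
    define F' where "F' = F - {e}"
    have deg': "vertex_degree F' ends v =
        (if v \<in> {x, y} then vertex_degree F ends v - 1 else vertex_degree F ends v)" for v
      using eF y by (auto simp: vertex_degree_def F'_def incident_edges_Diff)
    show ?thesis
    proof (cases "vertex_degree F ends y \<le> 1")
      case True
      have "f = e" if "f \<in> F" "y \<in> ends f" for f
      proof -
        have "{e, f} \<subseteq> incident_edges F ends y"
          using that eF y by auto
        then have "card {e, f} \<le> 1"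
          using True card_mono[of "incident_edges F ends y" "{e, f}"] less.prems(1)
          by (simp add: vertex_degree_def)
        then show ?thesis
          by (auto split: if_splits simp: card_insert_if)
      qed
      then have "\<forall>f\<in>F. ends f \<inter> {x, y} \<noteq> {} \<longrightarrow> ends f \<subseteq> {x, y}"
        using only_e y by blast
      then show ?thesis
        by (intro exI[of _ "{x, y}"] exI[of _ y]) simp
    next
      case False
      have "card F' < card F"
        unfolding F'_def using less.prems(1) eF(1) by (rule card_Diff1_less)
      moreover have "vertex_degree F' ends v \<le> 2" for v
        using less.prems(3)[of v] deg'[of v] by auto
      moreover have "vertex_degree F' ends y \<le> 1"
        using less.prems(3)[of y] deg'[of y] by auto
      ultimately obtain C z where C: "y \<in> C"
          "\<forall>e\<in>F'. ends e \<inter> C \<noteq> {} \<longrightarrow> ends e \<subseteq> C"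
          "\<forall>v\<in>C. vertex_degree F' ends v \<le> 1 \<longrightarrow> v = y \<or> v = z"
        using less.hyps[of F' y] less.prems(1,2) by (auto simp: F'_def)
      have "ends f \<subseteq> insert x C" if "f \<in> F" "ends f \<inter> insert x C \<noteq> {}" for f
      proof (cases "f = e")
        case True
        then show ?thesis using y C(1) by simp
      next
        case False
        then have "f \<in> F'" "x \<notin> ends f"
          using that only_e by (auto simp: F'_def)
        then show ?thesis using that C(2) by blast
      qed
      \<comment> \<open>The hypothesis for \<open>F'\<close> allows \<open>y\<close> and
        \<open>z\<close> as path ends. In \<open>F\<close> the vertex \<open>y\<close> has degree
        two, so it is no longer an end, and \<open>x\<close> takes its place.\<close>
      moreover have "v = x \<or> v = z" if "v \<in> insert x C" "vertex_degree F ends v \<le> 1" for v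
        using that False C(3) deg'[of v] by (cases "v = y") (auto split: if_splits)
      ultimately show ?thesis
        by (intro exI[of _ "insert x C"] exI[of _ z]) auto
    qed
  qed
qed

section \<open>Vizing fans\<close>

definition proper_coloring :: "'e set \<Rightarrow> ('e \<Rightarrow> 'v set) \<Rightarrow> nat \<Rightarrow> ('e \<Rightarrow> nat) \<Rightarrow> bool" where
  "proper_coloring E ends k \<pi> \<longleftrightarrow>
     \<pi> \<in> E \<rightarrow> {1..k} \<and> (\<forall>v. inj_on \<pi> (incident_edges E ends v))"

definition missing :: "'e set \<Rightarrow> ('e \<Rightarrow> 'v set) \<Rightarrow> nat \<Rightarrow> ('e \<Rightarrow> nat) \<Rightarrow> 'v \<Rightarrow> nat set" where
  "missing E ends k \<pi> v = {1..k} - \<pi> ` incident_edges E ends v"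

lemma proper_coloringD:
  assumes "proper_coloring E ends k \<pi>"
    and "e \<in> E" "f \<in> E" "v \<in> ends e" "v \<in> ends f" "\<pi> e = \<pi> f"
  shows "e = f"
  using assms unfolding proper_coloring_def by (meson incident_edges_iff inj_onD)

lemma card_missing_ge:
  assumes "finite E"
  shows "k - vertex_degree E ends v \<le> card (missing E ends k \<pi> v)"
proof -
  have "card (\<pi> ` incident_edges E ends v) \<le> vertex_degree E ends v"
    unfolding vertex_degree_def using assms by (simp add: card_image_le)
  moreover have "k - card (\<pi> ` incident_edges E ends v) \<le> card (missing E ends k \<pi> v)"
    unfolding missing_def
    using diff_card_le_card_Diff[of "\<pi> ` incident_edges E ends v" "{1..k}"] assms by simp
  ultimately show ?thesis by linarith
qed

text \<open>Serves two purposes: to colour the last uncoloured edge, and to recolour a coloured edge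
  after forgetting its colour.\<close>

lemma proper_coloring_extend:
  assumes \<pi>: "proper_coloring (E - {e}) ends k \<pi>" and e: "e \<in> E" "ends e = {x, y}"
    and \<alpha>: "\<alpha> \<in> missing (E - {e}) ends k \<pi> x" "\<alpha> \<in> missing (E - {e}) ends k \<pi> y"
  shows "proper_coloring E ends k (\<pi>(e := \<alpha>))"
  unfolding proper_coloring_def
proof (intro conjI allI)
  show "\<pi>(e := \<alpha>) \<in> E \<rightarrow> {1..k}"
    using \<pi> \<alpha> by (auto simp: proper_coloring_def missing_def)
  show "inj_on (\<pi>(e := \<alpha>)) (incident_edges E ends v)" for v
  proof (rule inj_onI)
    fix f g
    assume fg: "f \<in> incident_edges E ends v" "g \<in> incident_edges E ends v"
      and eq: "(\<pi>(e := \<alpha>)) f = (\<pi>(e := \<alpha>)) g"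
    have *: "\<pi> h \<noteq> \<alpha>" if "h \<in> E" "h \<noteq> e" "x \<in> ends h \<or> y \<in> ends h" for h
      using that \<alpha> by (auto simp: missing_def)
    show "f = g"
      using fg eq * e proper_coloringD[OF \<pi>, of f g v] by (auto split: if_splits)
  qed
qed

text \<open>A set closed under the \<open>\<alpha>\<close>- and \<open>\<beta>\<close>-coloured edges is a union of Kempe chains.\<close>

lemma kempe_swap:
  assumes \<pi>: "proper_coloring E ends k \<pi>" and \<alpha>\<beta>: "\<alpha> \<in> {1..k}" "\<beta> \<in> {1..k}"
    and closed: "\<And>e. e \<in> E \<Longrightarrow> \<pi> e \<in> {\<alpha>, \<beta>} \<Longrightarrow> ends e \<inter> C \<noteq> {} \<Longrightarrow> ends e \<subseteq> C"
  defines "\<pi>' \<equiv> \<lambda>e. if ends e \<inter> C \<noteq> {} then transpose \<alpha> \<beta> (\<pi> e) else \<pi> e"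
  shows "proper_coloring E ends k \<pi>'"
    and "v \<in> C \<Longrightarrow> missing E ends k \<pi>' v = transpose \<alpha> \<beta> ` missing E ends k \<pi> v"
    and "v \<notin> C \<Longrightarrow> missing E ends k \<pi>' v = missing E ends k \<pi> v"
    and "v \<notin> C \<Longrightarrow> e \<in> incident_edges E ends v \<Longrightarrow> \<pi>' e = \<pi> e"
proof -
  \<comment> \<open>If an edge at \<open>v\<close> meets \<open>C\<close> although \<open>v\<close>
    lies outside, closedness rules out both \<alpha> and \<beta> as its colour, so the transposition
    fixes that colour.\<close>
  have outside: "\<pi>' e = \<pi> e" if "v \<notin> C" "e \<in> incident_edges E ends v" for e v
    using that closed[of e] by (auto simp: \<pi>'_def transpose_def)
  have inside: "\<pi>' e = transpose \<alpha> \<beta> (\<pi> e)" if "v \<in> C" "e \<in> incident_edges E ends v" for e v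
    using that by (auto simp: \<pi>'_def)
  have range: "transpose \<alpha> \<beta> ` {1..k} = {1..k}"
    using \<alpha>\<beta> by (simp add: transpose_image_eq)
  show "v \<notin> C \<Longrightarrow> e \<in> incident_edges E ends v \<Longrightarrow> \<pi>' e = \<pi> e"
    by (rule outside)
  show "v \<notin> C \<Longrightarrow> missing E ends k \<pi>' v = missing E ends k \<pi> v"
    using outside[of v] unfolding missing_def by (metis (no_types, lifting) image_cong)
  show "missing E ends k \<pi>' v = transpose \<alpha> \<beta> ` missing E ends k \<pi> v" if "v \<in> C"
  proof -
    have "\<pi>' ` incident_edges E ends v = transpose \<alpha> \<beta> ` \<pi> ` incident_edges E ends v"
      using inside[OF that] by (simp add: image_image)
    then show ?thesis
      unfolding missing_def using range by (metis image_set_diff inj_transpose)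
  qed
  show "proper_coloring E ends k \<pi>'"
    unfolding proper_coloring_def
  proof (intro conjI allI)
    show "\<pi>' \<in> E \<rightarrow> {1..k}"
      using \<pi> range by (auto simp: \<pi>'_def proper_coloring_def Pi_iff)
    show "inj_on \<pi>' (incident_edges E ends v)" for v
    proof -
      have inj: "inj_on \<pi> (incident_edges E ends v)"
        using \<pi> by (simp add: proper_coloring_def)
      show ?thesis
      proof (cases "v \<in> C")
        case True
        have "inj_on (transpose \<alpha> \<beta> \<circ> \<pi>) (incident_edges E ends v)"
          by (simp add: comp_inj_on inj)
        then show ?thesis
          using inside[OF True] by (simp add: inj_on_def)
      next
        case False
        then show ?thesis
          using outside[OF False] inj by (simp add: inj_on_def)
      qed
    qed
  qed
qed

text \<open>Exchanging \<open>\<alpha>\<close> and \<open>\<beta>\<close> outside the component of \<open>x\<close>. That component is a path, so it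
  cannot contain both \<open>u\<close> and \<open>w\<close>.\<close>

lemma kempe_swap_away:
  assumes fin: "finite E" and two: "\<And>e. e \<in> E \<Longrightarrow> card (ends e) = 2"
    and \<pi>: "proper_coloring E ends k \<pi>"
    and \<alpha>: "\<alpha> \<in> missing E ends k \<pi> x"
    and \<beta>: "\<beta> \<in> missing E ends k \<pi> u" "\<beta> \<in> missing E ends k \<pi> w"
    and neq: "u \<noteq> w" "u \<noteq> x" "w \<noteq> x"
  obtains C \<pi>' where "proper_coloring E ends k \<pi>'" "x \<notin> C" "u \<in> C \<or> w \<in> C"
    "\<And>v. v \<in> C \<Longrightarrow> missing E ends k \<pi>' v = transpose \<alpha> \<beta> ` missing E ends k \<pi> v"
    "\<And>v. v \<notin> C \<Longrightarrow> missing E ends k \<pi>' v = missing E ends k \<pi> v"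
    "\<And>e. e \<in> incident_edges E ends x \<Longrightarrow> \<pi>' e = \<pi> e"
proof -
  define F where "F = {e \<in> E. \<pi> e \<in> {\<alpha>, \<beta>}}"
  have inj: "inj_on \<pi> (incident_edges F ends v)" for v
    using \<pi> unfolding proper_coloring_def F_def by (auto intro: inj_on_subset)
  have deg: "vertex_degree F ends v \<le> card A"
    if "\<pi> ` incident_edges F ends v \<subseteq> A" "finite A" for v A
    unfolding vertex_degree_def using card_image[OF inj, of v] card_mono[OF that(2,1)] by simp
  have "vertex_degree F ends v \<le> 2" for v
  proof -
    have "vertex_degree F ends v \<le> card {\<alpha>, \<beta>}"
      by (rule deg) (auto simp: F_def)
    also have "\<dots> \<le> 2" by (simp add: card_insert_if)
    finally show ?thesis .
  qed
  moreover have "vertex_degree F ends x \<le> 1"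
  proof -
    have "\<pi> ` incident_edges F ends x \<subseteq> {\<beta>}"
      using \<alpha> by (auto simp: F_def missing_def)
    then show ?thesis using deg[of x "{\<beta>}"] by simp
  qed
  ultimately obtain C z where C: "x \<in> C" "\<forall>e\<in>F. ends e \<inter> C \<noteq> {} \<longrightarrow> ends e \<subseteq> C"
      "\<forall>v\<in>C. vertex_degree F ends v \<le> 1 \<longrightarrow> v = x \<or> v = z"
    using path_component[of F ends x] fin two by (auto simp: F_def)
  have "vertex_degree F ends v \<le> 1" if "\<beta> \<in> missing E ends k \<pi> v" for v
  proof -
    have "\<pi> ` incident_edges F ends v \<subseteq> {\<alpha>}"
      using that by (auto simp: F_def missing_def)
    then show ?thesis using deg[of v "{\<alpha>}"] by simp
  qed
  then have "vertex_degree F ends u \<le> 1" "vertex_degree F ends w \<le> 1"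
    using \<beta> by blast+
  \<comment> \<open>\<open>u\<close> and \<open>w\<close> have degree at most one in
    \<open>F\<close>, and \<open>C\<close> has room for only one such vertex besides
    \<open>x\<close>, namely \<open>z\<close>.\<close>
  then have away: "u \<in> - C \<or> w \<in> - C"
    using C(3) neq by auto
  \<comment> \<open>Closedness under the edges of \<open>F\<close> passes to the complement.
    Swapping there leaves all colours at \<open>x\<close> intact.\<close>
  have closed: "ends e \<subseteq> - C"
    if "e \<in> E" "\<pi> e \<in> {\<alpha>, \<beta>}" "ends e \<inter> - C \<noteq> {}" for e
    using that C(2) by (auto simp: F_def)
  have \<alpha>\<beta>: "\<alpha> \<in> {1..k}" "\<beta> \<in> {1..k}"
    using \<alpha> \<beta> by (auto simp: missing_def)
  note swap = kempe_swap[OF \<pi> \<alpha>\<beta>, of "- C", OF closed]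
  show thesis
    by (rule that[where C = "- C", OF swap(1) _ _ swap(2,3,4)]) (use C(1) away in auto)
qed

section \<open>Fans at a centre \<open>x\<close> with one uncoloured edge \<open>e0\<close>\<close>

locale fan_center =
  fixes E :: "'e set" and ends :: "'e \<Rightarrow> 'v set" and k :: nat
    and x :: 'v and y :: "'e \<Rightarrow> 'v" and e0 :: 'e
  assumes finite_E: "finite E"
    and card_ends: "e \<in> E \<Longrightarrow> card (ends e) = 2"
    and e0: "e0 \<in> E" "x \<in> ends e0"
    and ends_center: "e \<in> E \<Longrightarrow> x \<in> ends e \<Longrightarrow> ends e = {x, y e}"
begin

abbreviation partial where "partial \<equiv> proper_coloring (E - {e0}) ends k"
abbreviation miss where "miss \<equiv> missing (E - {e0}) ends k"

lemma y_neq: "e \<in> E \<Longrightarrow> x \<in> ends e \<Longrightarrow> y e \<noteq> x"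
  using card_ends[of e] ends_center[of e] by auto

text \<open>Fans are listed backwards, from the last edge to the uncoloured edge \<open>e0\<close>.\<close>

inductive fan :: "('e \<Rightarrow> nat) \<Rightarrow> 'e list \<Rightarrow> bool" for \<pi> where
  fan_single: "fan \<pi> [e0]"
| fan_Cons: "fan \<pi> (g # gs) \<Longrightarrow> f \<in> E \<Longrightarrow> x \<in> ends f \<Longrightarrow> f \<notin> set (g # gs) \<Longrightarrow>
    \<pi> f \<in> miss \<pi> (y g) \<Longrightarrow> fan \<pi> (f # g # gs)"

text \<open>The union of all fans, taken in place of a single maximal fan: every edge of a fan is
  the last edge of an initial part of it.\<close>

definition fan_edges :: "('e \<Rightarrow> nat) \<Rightarrow> 'e set" where
  "fan_edges \<pi> = {f. \<exists>gs. fan \<pi> (f # gs)}"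

lemma fan_subset: "fan \<pi> gs \<Longrightarrow> set gs \<subseteq> incident_edges E ends x \<and> e0 \<in> set gs"
  by (induction rule: fan.induct) (use e0 in auto)

lemma fan_edges_subset: "fan_edges \<pi> \<subseteq> incident_edges E ends x"
  using fan_subset unfolding fan_edges_def by fastforce

lemma e0_fan_edges: "e0 \<in> fan_edges \<pi>"
  unfolding fan_edges_def using fan_single by blast

lemma set_fan_subset: "fan \<pi> gs \<Longrightarrow> set gs \<subseteq> fan_edges \<pi>"
proof (induction rule: fan.induct)
  case fan_single
  then show ?case by (simp add: e0_fan_edges)
next
  case (fan_Cons g gs f)
  then have "f \<in> fan_edges \<pi>"
    unfolding fan_edges_def using fan.fan_Cons by blast
  with fan_Cons.IH show ?case by simp
qed

text \<open>Fans have no repeated edges, but an edge that already occurs in the fan ends a shorter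
  one. Hence \<open>fan_edges\<close> is closed under fan steps without restriction.\<close>

lemma fan_edges_step:
  assumes "g \<in> fan_edges \<pi>" "f \<in> E" "x \<in> ends f" "\<pi> f \<in> miss \<pi> (y g)"
  shows "f \<in> fan_edges \<pi>"
proof -
  obtain gs where gs: "fan \<pi> (g # gs)"
    using assms(1) by (auto simp: fan_edges_def)
  show ?thesis
  proof (cases "f \<in> set (g # gs)")
    case True
    then show ?thesis using set_fan_subset[OF gs] by blast
  next
    case False
    then show ?thesis
      using fan_Cons[OF gs] assms unfolding fan_edges_def by blast
  qed
qed

text \<open>By properness \<open>f\<close> was the only edge at \<open>x\<close> with its old
  colour, so that colour becomes free there. At any vertex the only missing colour that can be lost
  is \<alpha>.\<close>

lemma partial_recolor:
  assumes \<pi>: "partial \<pi>" and f: "f \<in> E" "x \<in> ends f" "f \<noteq> e0"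
    and \<alpha>: "\<alpha> \<in> miss \<pi> x" "\<alpha> \<in> miss \<pi> (y f)"
  shows "partial (\<pi>(f := \<alpha>))" and "\<pi> f \<in> miss (\<pi>(f := \<alpha>)) x"
    and "miss \<pi> v - {\<alpha>} \<subseteq> miss (\<pi>(f := \<alpha>)) v"
proof -
  have sub: "proper_coloring (E - {e0} - {f}) ends k \<pi>"
    using \<pi> by (auto simp: proper_coloring_def incident_edges_Diff intro: inj_on_diff)
  show "partial (\<pi>(f := \<alpha>))"
    using f \<alpha> ends_center[of f]
    by (intro proper_coloring_extend[OF sub, of x "y f"]) (auto simp: missing_def)
  have "\<pi> f \<noteq> \<alpha>"
    using f \<alpha> by (auto simp: missing_def)
  moreover have "\<pi> f \<in> {1..k}"
    using \<pi> f by (auto simp: proper_coloring_def)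
  moreover have "\<pi> g \<noteq> \<pi> f" if "g \<in> E" "g \<noteq> e0" "g \<noteq> f" "x \<in> ends g" for g
    using proper_coloringD[OF \<pi>, of g f x] that f by auto
  ultimately show "\<pi> f \<in> miss (\<pi>(f := \<alpha>)) x"
    by (fastforce simp: missing_def split: if_splits)
  show "miss \<pi> v - {\<alpha>} \<subseteq> miss (\<pi>(f := \<alpha>)) v"
    by (auto simp: missing_def split: if_splits)
qed

text \<open>The colours that link the fan belong to edges at \<open>x\<close> other than
  \<open>f\<close>. They do not change, and they differ from \<alpha>, which is missing at
  \<open>x\<close>; so each is still missing where the fan requires it.\<close>

lemma fan_recolor:
  assumes "fan \<pi> gs" and \<pi>: "partial \<pi>" and f: "f \<in> E" "x \<in> ends f" "f \<notin> set gs"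
    and \<alpha>: "\<alpha> \<in> miss \<pi> x" "\<alpha> \<in> miss \<pi> (y f)"
  shows "fan (\<pi>(f := \<alpha>)) gs"
  using assms(1) f(3)
proof (induction rule: fan.induct)
  case fan_single
  show ?case by (rule fan.fan_single)
next
  case (fan_Cons g gs h)
  have "e0 \<in> set (g # gs)"
    using fan_subset[OF fan_Cons.hyps(1)] by blast
  then have "h \<noteq> e0" "f \<noteq> e0"
    using fan_Cons.hyps(4) fan_Cons.prems by auto
  then have "\<pi> h \<noteq> \<alpha>"
    using \<alpha>(1) fan_Cons.hyps(2,3) by (auto simp: missing_def)
  then have "\<pi> h \<in> miss (\<pi>(f := \<alpha>)) (y g)"
    using partial_recolor(3)[OF \<pi> f(1,2) \<open>f \<noteq> e0\<close> \<alpha>] fan_Cons.hyps(5) by blast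
  then show ?case
    using fan_Cons by (intro fan.fan_Cons) (auto simp del: fun_upd_apply simp: fun_upd_other)
qed

text \<open>Recolouring the last edge of the fan with \<open>\<alpha>\<close> frees its old colour both at \<open>x\<close> and at
  the end of the previous edge, so the fan gets shorter.\<close>

lemma fan_augment:
  assumes "fan \<pi> (f # gs)" and "partial \<pi>" and "\<alpha> \<in> miss \<pi> x" and "\<alpha> \<in> miss \<pi> (y f)"
  shows "\<exists>\<pi>'. proper_coloring E ends k \<pi>'"
  using assms
proof (induction gs arbitrary: f \<pi> \<alpha>)
  case Nil
  then have "f = e0"
    by (auto elim: fan.cases)
  then show ?case
    using proper_coloring_extend[of E e0 ends k \<pi> x "y e0" \<alpha>] Nil e0 ends_center[of e0] by auto
next
  case (Cons g gs)
  from Cons.prems(1) have fan: "fan \<pi> (g # gs)" and f: "f \<in> E" "x \<in> ends f" "f \<notin> set (g # gs)"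
    and col: "\<pi> f \<in> miss \<pi> (y g)"
    by (auto elim: fan.cases)
  have "f \<noteq> e0"
    using fan_subset[OF fan] f(3) by auto
  note re = partial_recolor[OF Cons.prems(2) f(1,2) \<open>f \<noteq> e0\<close> Cons.prems(3,4)]
  have "\<pi> f \<noteq> \<alpha>"
    using f \<open>f \<noteq> e0\<close> Cons.prems(3) by (auto simp: missing_def)
  then have "\<pi> f \<in> miss (\<pi>(f := \<alpha>)) (y g)"
    using col re(3) by blast
  then show ?case
    using Cons.IH[OF fan_recolor[OF fan Cons.prems(2) f Cons.prems(3,4)] re(1,2)] by blast
qed

lemma fan_edges_augment:
  assumes "f \<in> fan_edges \<pi>" and "partial \<pi>" and "\<alpha> \<in> miss \<pi> x" and "\<alpha> \<in> miss \<pi> (y f)"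
  shows "\<exists>\<pi>'. proper_coloring E ends k \<pi>'"
  using assms fan_augment unfolding fan_edges_def by blast

text \<open>A common missing colour \<beta> would allow a Kempe swap away from \<open>x\<close>
  after which \<alpha> is missing at \<open>y f\<close> or \<open>y g\<close> and still at
  \<open>x\<close>. Both edges remain fan edges after the swap, so the colouring could be
  augmented.\<close>

lemma fan_miss_disjoint:
  assumes no: "\<nexists>\<pi>'. proper_coloring E ends k \<pi>'" and \<pi>: "partial \<pi>"
    and \<alpha>: "\<alpha> \<in> miss \<pi> x"
    and fg: "f \<in> fan_edges \<pi>" "g \<in> fan_edges \<pi>" "y f \<noteq> y g"
  shows "miss \<pi> (y f) \<inter> miss \<pi> (y g) = {}"
proof (rule ccontr)
  assume "miss \<pi> (y f) \<inter> miss \<pi> (y g) \<noteq> {}"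
  then obtain \<beta> where \<beta>: "\<beta> \<in> miss \<pi> (y f)" "\<beta> \<in> miss \<pi> (y g)" by blast
  have "y f \<noteq> x" "y g \<noteq> x"
    using fg fan_edges_subset y_neq by fastforce+
  from kempe_swap_away[OF _ _ \<pi> \<alpha> \<beta> fg(3) this] finite_E card_ends
  obtain C \<pi>' where \<pi>': "partial \<pi>'" and C: "x \<notin> C" "y f \<in> C \<or> y g \<in> C"
    and inC: "\<And>v. v \<in> C \<Longrightarrow> miss \<pi>' v = transpose \<alpha> \<beta> ` miss \<pi> v"
    and outC: "\<And>v. v \<notin> C \<Longrightarrow> miss \<pi>' v = miss \<pi> v"
    and same: "\<And>e. e \<in> incident_edges (E - {e0}) ends x \<Longrightarrow> \<pi>' e = \<pi> e"
    by (metis DiffD1 finite_Diff)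
  have \<alpha>': "\<alpha> \<in> miss \<pi>' x"
    using \<alpha> outC C(1) by simp
  have no_\<alpha>: "\<alpha> \<notin> miss \<pi>' (y h)" if "h \<in> fan_edges \<pi>'" for h
    using fan_edges_augment[OF that \<pi>' \<alpha>'] no by blast
  \<comment> \<open>Inside \<open>C\<close> a missing \<beta> turns into a missing \<alpha>, and a
    fan edge of \<open>\<pi>'\<close> with such an end could be augmented.\<close>
  have \<beta>_out: "y h \<notin> C" if "h \<in> fan_edges \<pi>'" "\<beta> \<in> miss \<pi> (y h)" for h
    using no_\<alpha>[OF that(1)] inC[of "y h"] that(2) by (metis imageI transpose_apply_second)
  \<comment> \<open>A linking colour \<open>\<pi> h\<close> is never \<alpha>, which is missing at
    \<open>x\<close>. If it were \<beta> at an end in \<open>C\<close>, \<open>\<beta>_out\<close>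
    would be violated; so the swap does not affect any link.\<close>
  have keep: "set gs \<subseteq> fan_edges \<pi>'" if "fan \<pi> gs" for gs
    using that
  proof (induction rule: fan.induct)
    case fan_single
    then show ?case by (simp add: e0_fan_edges)
  next
    case (fan_Cons g gs h)
    have "h \<noteq> e0"
      using fan_subset[OF fan_Cons.hyps(1)] fan_Cons.hyps(4) by auto
    then have h: "h \<in> incident_edges (E - {e0}) ends x"
      using fan_Cons.hyps by simp
    then have "\<pi> h \<noteq> \<alpha>"
      using \<alpha> by (auto simp: missing_def)
    have g: "g \<in> fan_edges \<pi>'"
      using fan_Cons.IH by simp
    have "\<pi> h \<in> miss \<pi>' (y g)"
    proof (cases "y g \<in> C")
      case True
      then have "\<pi> h \<noteq> \<beta>"
        using \<beta>_out[OF g] fan_Cons.hyps(5) by blast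
      then show ?thesis
        using inC[OF True] fan_Cons.hyps(5) \<open>\<pi> h \<noteq> \<alpha>\<close>
        by (metis imageI transpose_apply_other)
    next
      case False
      then show ?thesis using outC fan_Cons.hyps(5) by simp
    qed
    then have "h \<in> fan_edges \<pi>'"
      using fan_edges_step[OF g] same[OF h] fan_Cons.hyps(2,3) by simp
    then show ?case using fan_Cons.IH by simp
  qed
  have "h \<in> fan_edges \<pi>'" if "h \<in> fan_edges \<pi>" for h
  proof -
    obtain gs where "fan \<pi> (h # gs)"
      using \<open>h \<in> fan_edges \<pi>\<close> by (auto simp: fan_edges_def)
    from keep[OF this] show ?thesis by simp
  qed
  then have "f \<in> fan_edges \<pi>'" "g \<in> fan_edges \<pi>'"
    using fg by simp_all
  then show False
    using \<beta>_out \<beta> C(2) by blast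
qed

text \<open>Double counting of the colours missing at the fan ends. These sets are disjoint, and
  each is at least as large as the multiplicity towards \<open>x\<close>, so together they have at
  least as many colours as the fan has edges. But all these colours occur on fan edges other than
  \<open>e0\<close>.\<close>

theorem extend_coloring:
  assumes \<pi>: "partial \<pi>" and deg_x: "vertex_degree E ends x \<le> k"
    and deg_y: "\<And>e. e \<in> E \<Longrightarrow> x \<in> ends e \<Longrightarrow>
      vertex_degree E ends (y e) + card (edges_between E ends x (y e)) \<le> k"
  shows "\<exists>\<pi>'. proper_coloring E ends k \<pi>'"
proof (rule ccontr)
  assume no: "\<nexists>\<pi>'. proper_coloring E ends k \<pi>'"
  let ?R = "fan_edges \<pi>"
  \<comment> \<open>Parallel fan edges yield the same end, so the count runs over vertices, weighted
    by multiplicity.\<close>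
  let ?Y = "y ` ?R"
  have finR: "finite ?R"
    using fan_edges_subset finite_E by (meson finite_incident_edges finite_subset)
  \<comment> \<open>As \<open>e0\<close> is uncoloured, some colour is missing at \<open>x\<close>
    even if the degree of \<open>x\<close> is \<open>k\<close>.\<close>
  have "vertex_degree (E - {e0}) ends x < vertex_degree E ends x"
    unfolding vertex_degree_def incident_edges_Diff
    using finite_E e0 by (intro card_Diff1_less) auto
  then have "miss \<pi> x \<noteq> {}"
    using card_missing_ge[of "E - {e0}" k ends x \<pi>] finite_E deg_x by auto
  then obtain \<alpha> where \<alpha>: "\<alpha> \<in> miss \<pi> x" by blast
  \<comment> \<open>A colour missing at a fan end is present at \<open>x\<close>, since otherwise
    the fan could be augmented. The edge at \<open>x\<close> carrying it then extends the
    fan.\<close>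
  have "(\<Union>v\<in>?Y. miss \<pi> v) \<subseteq> \<pi> ` (?R - {e0})"
  proof
    fix \<gamma>
    assume "\<gamma> \<in> (\<Union>v\<in>?Y. miss \<pi> v)"
    then obtain g where g: "g \<in> ?R" "\<gamma> \<in> miss \<pi> (y g)" by blast
    have "\<gamma> \<notin> miss \<pi> x"
      using fan_edges_augment[OF g(1) \<pi> _ g(2)] no by blast
    then obtain f where "f \<in> E" "f \<noteq> e0" "x \<in> ends f" "\<gamma> = \<pi> f"
      using g(2) by (auto simp: missing_def)
    then show "\<gamma> \<in> \<pi> ` (?R - {e0})"
      using fan_edges_step[OF g(1), of f] g(2) by blast
  qed
  then have "card (\<Union>v\<in>?Y. miss \<pi> v) \<le> card (\<pi> ` (?R - {e0}))"
    using finR by (intro card_mono) auto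
  also have "\<dots> \<le> card (?R - {e0})"
    using finR by (intro card_image_le) simp
  \<comment> \<open>The strict inequality of the chain: \<open>e0\<close> counts as a fan edge but
    carries no colour.\<close>
  also have "\<dots> < card ?R"
    using finR e0_fan_edges by (rule card_Diff1_less)
  also have "card ?R \<le> card (\<Union>v\<in>?Y. edges_between E ends x v)"
    using finR finite_E fan_edges_subset ends_center
    by (intro card_mono) (fastforce simp: edges_between_def)+
  also have "\<dots> \<le> (\<Sum>v\<in>?Y. card (edges_between E ends x v))"
    using finR by (intro card_UN_le) simp
  also have "\<dots> \<le> (\<Sum>v\<in>?Y. card (miss \<pi> v))"
  proof (rule sum_mono)
    fix v assume "v \<in> ?Y"
    then obtain f where f: "f \<in> E" "x \<in> ends f" "v = y f"
      using fan_edges_subset by fastforce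
    have "k - vertex_degree (E - {e0}) ends v \<le> card (miss \<pi> v)"
      using finite_E by (intro card_missing_ge) simp
    moreover have "vertex_degree (E - {e0}) ends v \<le> vertex_degree E ends v"
      using finite_E by (intro vertex_degree_mono) auto
    ultimately show "card (edges_between E ends x v) \<le> card (miss \<pi> v)"
      using deg_y[OF f(1,2)] f(3) by simp
  qed
  also have "\<dots> = card (\<Union>v\<in>?Y. miss \<pi> v)"
    using finR fan_miss_disjoint[OF no \<pi> \<alpha>]
    by (intro card_UN_disjoint[symmetric]) (auto simp: missing_def)
  finally show False by simp
qed

end

section \<open>Proper colourings\<close>

text \<open>The last assumption is the edge form of stability: the vertices violating the bound span
  no edge. In this form it passes to subgraphs, so the induction can delete an edge.\<close>

theorem proper_coloring_exists:
  assumes "finite E" and "\<And>e. e \<in> E \<Longrightarrow> card (ends e) = 2"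
    and "\<And>v. vertex_degree E ends v \<le> k"
    and "\<And>e. e \<in> E \<Longrightarrow> \<exists>v\<in>ends e. \<forall>w.
      vertex_degree E ends v + card (edges_between E ends v w) \<le> k"
  shows "\<exists>\<pi>. proper_coloring E ends k \<pi>"
  using assms
proof (induction "card E" arbitrary: E rule: less_induct)
  case less
  define good where
    "good v \<longleftrightarrow> (\<forall>w. vertex_degree E ends v + card (edges_between E ends v w) \<le> k)" for v
  have good_end: "\<exists>v\<in>ends e. good v" if "e \<in> E" for e
    using less.prems(4)[OF that] by (simp add: good_def)
  show ?case
  proof (cases "E = {}")
    case True
    then show ?thesis by (auto simp: proper_coloring_def incident_edges_def)
  next
    case False
    have "\<exists>e0\<in>E. \<exists>x\<in>ends e0. \<forall>e\<in>E. x \<in> ends e \<longrightarrow> (\<forall>z\<in>ends e - {x}. good z)"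
    proof (cases "\<exists>e\<in>E. \<exists>x\<in>ends e. \<not> good x")
      case True
      then obtain e0 x where x: "e0 \<in> E" "x \<in> ends e0" "\<not> good x" by blast
      \<comment> \<open>Every edge at the bad vertex \<open>x\<close> needs a good end, which must
        be the other one.\<close>
      have "good z" if "e \<in> E" "x \<in> ends e" "z \<in> ends e - {x}" for e z
      proof -
        have "ends e = {x, z}"
          using card_2_other_end[OF less.prems(2)[OF that(1)] that(2)] that(3) by auto
        then show ?thesis
          using good_end[OF that(1)] x(3) by auto
      qed
      with x show ?thesis by blast
    next
      case no_bad: False
      obtain e0 where "e0 \<in> E" using False by blast
      with no_bad good_end show ?thesis by blast
    qed
    then obtain e0 x where e0: "e0 \<in> E" "x \<in> ends e0"
      and nbr: "\<And>e z. e \<in> E \<Longrightarrow> x \<in> ends e \<Longrightarrow> z \<in> ends e \<Longrightarrow> z \<noteq> x \<Longrightarrow> good z"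
      by blast
    have "\<exists>z. ends e = {x, z}" if "e \<in> E" "x \<in> ends e" for e
      using card_2_other_end[OF less.prems(2)[OF that(1)] that(2)] by blast
    then obtain y where y: "\<And>e. e \<in> E \<Longrightarrow> x \<in> ends e \<Longrightarrow> ends e = {x, y e}"
      by metis
    interpret fan_center E ends k x y e0
      using less.prems e0 y by unfold_locales auto
    have "\<exists>\<pi>. proper_coloring (E - {e0}) ends k \<pi>"
    proof (rule less.hyps)
      show "card (E - {e0}) < card E"
        using less.prems(1) e0(1) by (rule card_Diff1_less)
      have deg: "vertex_degree (E - {e0}) ends v \<le> vertex_degree E ends v" for v
        using less.prems(1) by (intro vertex_degree_mono) auto
      then show "vertex_degree (E - {e0}) ends v \<le> k" for v
        using less.prems(3) le_trans by blast
      have "card (edges_between (E - {e0}) ends v w) \<le> card (edges_between E ends v w)" for v w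
        using less.prems(1) by (intro card_edges_between_mono) auto
      then show "\<exists>v\<in>ends e. \<forall>w.
          vertex_degree (E - {e0}) ends v + card (edges_between (E - {e0}) ends v w) \<le> k"
        if "e \<in> E - {e0}" for e
        using less.prems(4)[of e] that deg by (meson DiffD1 add_mono le_trans)
    qed (use less.prems in auto)
    then obtain \<pi> where "partial \<pi>" by blast
    then show ?thesis
    proof (rule extend_coloring[OF _ less.prems(3)])
      fix e assume e: "e \<in> E" "x \<in> ends e"
      then have "good (y e)"
        using nbr[of e "y e"] y_neq y by auto
      then show "vertex_degree E ends (y e) + card (edges_between E ends x (y e)) \<le> k"
        unfolding good_def edges_between_def by (metis insert_commute)
    qed
  qed
qed

section \<open>Reduction to proper colouring by detaching edge ends\<close>

lemma card_edges_between_le_max_multiplicity: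
  assumes "multigraph V E ends"
  shows "card (edges_between E ends v w) \<le> max_multiplicity V E ends v"
proof (cases "edges_between E ends v w = {}")
  case False
  interpret multigraph V E ends by fact
  obtain e where e: "e \<in> E" "ends e = {v, w}"
    using False by (auto simp: edges_between_def)
  \<comment> \<open>An edge forces \<open>w\<close> into the range of the maximum; for all other
    \<open>w\<close> there is nothing to count.\<close>
  then have "w \<in> V - {v}"
    using ends_subset[OF e(1)] card_ends[OF e(1)] by auto
  then show ?thesis
    unfolding max_multiplicity_def using finite_verts by (intro Max_ge) auto
qed simp

theorem theorem1p6:
  fixes V :: "'v set" and E :: "'e set" and ends :: "'e \<Rightarrow> 'v set"
    and k :: nat and c :: "'v \<Rightarrow> nat"
  assumes "multigraph V E ends"
    and "k > 0"
    and "\<And>v. v \<in> V \<Longrightarrow> c v \<le> min (vertex_degree E ends v) k"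
    and "stable_set V E ends {v \<in> V. c v + max_multiplicity V E ends v > k}"
  shows "\<exists>\<pi> \<in> E \<rightarrow> {1..k}. \<forall>v\<in>V. card (\<pi> ` incident_edges E ends v) \<ge> c v"
proof -
  interpret multigraph V E ends by fact
  have stable: "edges_between E ends u w = {}"
    if "u \<in> V" "c u + max_multiplicity V E ends u > k"
      "w \<in> V" "c w + max_multiplicity V E ends w > k" for u w
    using assms(4) that by (simp add: stable_set_def)
  have inc_finite: "finite (incident_edges E ends v)" for v
    using finite_edges by simp
  show ?thesis
  \<comment> \<open>A detached end may have degree and multiplicity one, and the bound for it then
    reads 1 + 1 \<le> \<open>k\<close>. For \<open>k = 1\<close> a constant colouring does, because
    \<open>c v\<close> is at most one, and zero at isolated vertices.\<close>
  proof (cases "k = 1")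
    case True
    have "c v \<le> card ((\<lambda>_. 1 :: nat) ` incident_edges E ends v)" if "v \<in> V" for v
    proof (cases "incident_edges E ends v = {}")
      case True
      then show ?thesis
        using assms(3)[OF that] by (simp add: vertex_degree_def)
    next
      case False
      then show ?thesis
        using assms(3)[OF that] \<open>k = 1\<close> by (simp add: image_constant_conv)
    qed
    then show ?thesis
      using assms(2) by (intro bexI[of _ "\<lambda>_. 1"]) auto
  next
    case False
    then have k2: "k \<ge> 2" using assms(2) by simp
    have "\<exists>K. K \<subseteq> incident_edges E ends v \<and> card K = c v" if "v \<in> V" for v
      using assms(3)[OF that] obtain_subset_with_card_n[of "c v" "incident_edges E ends v"]
      by (auto simp: vertex_degree_def)
    then obtain K where K: "\<And>v. v \<in> V \<Longrightarrow> K v \<subseteq> incident_edges E ends v"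
        "\<And>v. v \<in> V \<Longrightarrow> card (K v) = c v"
      by metis
    text \<open>\<open>(v, None)\<close> is what remains of \<open>v\<close>; \<open>(v, Some e)\<close> is the new vertex for the end of
      \<open>e\<close> detached from \<open>v\<close>.\<close>
    define ends' where
      "ends' e = (\<lambda>v. (v, if e \<in> K v then None else Some e)) ` ends e" for e
    have fst_ends': "fst ` ends' e = ends e" for e
      by (simp add: ends'_def image_image)
    \<comment> \<open>Hence \<open>(v, None)\<close> has degree exactly \<open>c v\<close>.\<close>
    have inc_None: "incident_edges E ends' (v, None) = K v" if "v \<in> V" for v
    proof -
      have "(v, None) \<in> ends' e \<longleftrightarrow> v \<in> ends e \<and> e \<in> K v" for e
        by (auto simp: ends'_def split: if_splits)
      then show ?thesis
        using K(1)[OF that] by (auto simp: subset_iff)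
    qed
    have inc_Some: "incident_edges E ends' (v, Some e) \<subseteq> {e}" for v e
      by (auto simp: ends'_def split: if_splits)
    have leaf: "vertex_degree E ends' (v, Some e) \<le> 1"
        "card (edges_between E ends' (v, Some e) w) \<le> 1" for v e w
    proof -
      show "vertex_degree E ends' (v, Some e) \<le> 1"
        unfolding vertex_degree_def using card_mono[OF _ inc_Some] by fastforce
      have "edges_between E ends' (v, Some e) w \<subseteq> {e}"
        using inc_Some[of v e] by (force simp: edges_between_def)
      then show "card (edges_between E ends' (v, Some e) w) \<le> 1"
        using card_mono[of "{e}"] by fastforce
    qed
    have "\<exists>\<pi>. proper_coloring E ends' k \<pi>"
    proof (rule proper_coloring_exists[OF finite_edges])
      show "card (ends' e) = 2" if "e \<in> E" for e
        unfolding ends'_def using card_ends[OF that] by (subst card_image) (auto intro: inj_onI)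
      show "vertex_degree E ends' v \<le> k" for v
      proof (cases v)
        case (Pair u t)
        show ?thesis
        proof (cases t)
          case (Some e)
          then show ?thesis using leaf(1)[of u e] Pair k2 by simp
        next
          case None
          show ?thesis
          proof (cases "u \<in> V")
            case True
            then show ?thesis
              using Pair None inc_None K(2) assms(3) by (simp add: vertex_degree_def)
          next
            case False
            \<comment> \<open>Outside \<open>V\<close> the set \<open>K u\<close> is unspecified,
              but no edge of \<open>E\<close> has an end there.\<close>
            then have "incident_edges E ends' v = {}"
              using ends_subset Pair fst_ends' by (fastforce simp: ends'_def)
            then show ?thesis by (simp add: vertex_degree_def)
          qed
        qed
      qed
      show "\<exists>v\<in>ends' e. \<forall>w. vertex_degree E ends' v + card (edges_between E ends' v w) \<le> k"
        if e: "e \<in> E" for e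
      proof (cases "\<exists>v. (v, Some e) \<in> ends' e")
        case True
        then obtain v where "(v, Some e) \<in> ends' e" by blast
        moreover have "vertex_degree E ends' (v, Some e) + card (edges_between E ends' (v, Some e) w)
            \<le> k" for w
          using leaf(1)[of v e] leaf(2)[of v e w] k2 by linarith
        ultimately show ?thesis by blast
      next
        case False
        \<comment> \<open>With no end detached, \<open>e\<close> still joins the remains of two
          original vertices. Stability makes one of them satisfy the bound, and this vertex is the
          required end.\<close>
        then have kept: "(v, None) \<in> ends' e" if "v \<in> ends e" for v
        proof -
          have "(v, if e \<in> K v then None else Some e) \<in> ends' e"
            using that by (simp add: ends'_def)
          then show ?thesis using False by (cases "e \<in> K v") auto
        qed
        obtain u w where uw: "ends e = {u, w}"
          using card_ends[OF e] by (auto simp: card_2_iff)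
        then have "e \<in> edges_between E ends u w" "u \<in> V" "w \<in> V"
          using e ends_subset[OF e] by (auto simp: edges_between_def)
        then have "\<not> (c u + max_multiplicity V E ends u > k \<and> c w + max_multiplicity V E ends w > k)"
          using stable[of u w] by auto
        then obtain v where v: "v \<in> ends e" "v \<in> V" "c v + max_multiplicity V E ends v \<le> k"
          using uw \<open>u \<in> V\<close> \<open>w \<in> V\<close> by (metis insertCI not_less)
        \<comment> \<open>Projection to the first component sends parallel edges to parallel edges,
          so detaching does not increase multiplicities.\<close>
        have mult: "card (edges_between E ends' (v, None) w) \<le> max_multiplicity V E ends v" for w
        proof -
          have "edges_between E ends' (v, None) w \<subseteq> edges_between E ends v (fst w)"
          proof
            fix f assume f: "f \<in> edges_between E ends' (v, None) w"
            then have "ends f = fst ` {(v, None), w}"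
              using fst_ends'[of f] by (simp add: edges_between_def)
            then show "f \<in> edges_between E ends v (fst w)"
              using f by (simp add: edges_between_def)
          qed
          then have "card (edges_between E ends' (v, None) w)
              \<le> card (edges_between E ends v (fst w))"
            using finite_edges by (intro card_mono) (auto simp: edges_between_def)
          also have "\<dots> \<le> max_multiplicity V E ends v"
            by (rule card_edges_between_le_max_multiplicity) fact
          finally show ?thesis .
        qed
        have "vertex_degree E ends' (v, None) + card (edges_between E ends' (v, None) w) \<le> k"
          for w
          using v(3) mult[of w] inc_None[OF v(2)] K(2)[OF v(2)] by (simp add: vertex_degree_def)
        then show ?thesis by (intro bexI[OF _ kept[OF v(1)]] allI)
      qed
    qed
    then obtain \<pi> where \<pi>: "\<pi> \<in> E \<rightarrow> {1..k}" "\<And>v. inj_on \<pi> (incident_edges E ends' v)"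
      by (auto simp: proper_coloring_def)
    have "c v \<le> card (\<pi> ` incident_edges E ends v)" if "v \<in> V" for v
    proof -
      \<comment> \<open>Properness at \<open>(v, None)\<close> makes the kept edges at
        \<open>v\<close> receive distinct colours; the detached ones can only add more.\<close>
      have "c v = card (\<pi> ` K v)"
        using \<pi>(2)[of "(v, None)"] inc_None[OF that] K(2)[OF that] by (simp add: card_image)
      also have "\<dots> \<le> card (\<pi> ` incident_edges E ends v)"
        using K(1)[OF that] inc_finite by (intro card_mono) auto
      finally show ?thesis .
    qed
    with \<pi>(1) show ?thesis by blast
  qed
qed

end
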